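(* Let $R$ be a commutative ring with $1\neq 0$ and let $S$ be a multiplicatively closed subset of $R$. (1) The quasi-compact open subsets of $\mathrm{Spec}_SR$ with respect to the $S$-flat topology are exactly the sets $V_S(I)$ where $I$ is a finitely generated ideal of $R$. (2) $\mathrm{Spec}_SR$ is quasi-compact with respect to the $S$-flat topology. (3) Let $I$ be an ideal of $R$. Then $V_S(I)$ is open with respect to the $S$-flat topology if and only if $\sqrt[S]{I}=\sqrt[S]{J}$ for some finitely generated ideal $J$ of $R$.
   Context: A multiplicatively closed subset $S$ of $R$ satisfies $0\notin S$, $1\in S$, and $ss'\in S$ for all $s,s'\in S$. An ideal $P$ of $R$ is $S$-prime if $P\cap S=\emptyset$ and there exists $s\in S$ such that for all $a,b\in R$, $ab\in P$ implies $sa\in P$ or $sb\in P$. $\mathrm{Spec}_SR$ is the set of all $S$-prime ideals of $R$. For $E\subseteq R$, $V_S(E)=\{P\in\mathrm{Spec}_SR : sE\subseteq P \text{ for some } s\in S\}$; write $V_S(f)=V_S(\{f\})$. The $S$-flat topology on $\mathrm{Spec}_SR$ is the topology having the sets $V_S(f)$, $f\in R$, as a sub-basis of open sets; the sets $V_S(J)$ with $J$ a finitely generated ideal form a basis of it. The $S$-radical of an ideal $I$ is $\sqrt[S]{I}=\{a\in R : sa^n\in I\text{ for some } s\in S \text{ and } n\in\mathbb{N}\}$ ($\mathbb{N}$ the positive integers). Quasi-compact means every open cover has a finite subcover. *)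

theory Defs
  imports "HOL-Algebra.Ideal" "HOL-Analysis.Abstract_Topology"
begin

definition mult_closed_subset :: "('a, 'b) ring_scheme \<Rightarrow> 'a set \<Rightarrow> bool"
  where "mult_closed_subset R S \<longleftrightarrow> submonoid S R \<and> \<zero>\<^bsub>R\<^esub> \<notin> S"

definition S_prime :: "('a, 'b) ring_scheme \<Rightarrow> 'a set \<Rightarrow> 'a set \<Rightarrow> bool"
  where "S_prime R S P \<longleftrightarrow>
    ideal P R \<and> P \<inter> S = {} \<and>
    (\<exists>s\<in>S. \<forall>a\<in>carrier R. \<forall>b\<in>carrier R.
       a \<otimes>\<^bsub>R\<^esub> b \<in> P \<longrightarrow> s \<otimes>\<^bsub>R\<^esub> a \<in> P \<or> s \<otimes>\<^bsub>R\<^esub> b \<in> P)"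

definition Spec_S :: "('a, 'b) ring_scheme \<Rightarrow> 'a set \<Rightarrow> 'a set set"
  where "Spec_S R S = {P. S_prime R S P}"

definition V_S :: "('a, 'b) ring_scheme \<Rightarrow> 'a set \<Rightarrow> 'a set \<Rightarrow> 'a set set"
  where "V_S R S E = {P \<in> Spec_S R S. \<exists>s\<in>S. (\<lambda>e. s \<otimes>\<^bsub>R\<^esub> e) ` E \<subseteq> P}"

text \<open>
  The carrier of \<open>topology_generated_by\<close> is the union of the sub-basis;
  \<open>topspace_S_flat_topology\<close> shows that here it is the whole of \<open>Spec_S R S\<close>.
\<close>

definition S_flat_topology :: "('a, 'b) ring_scheme \<Rightarrow> 'a set \<Rightarrow> 'a set topology"
  where "S_flat_topology R S = topology_generated_by {V_S R S {f} | f. f \<in> carrier R}"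

definition S_radical :: "('a, 'b) ring_scheme \<Rightarrow> 'a set \<Rightarrow> 'a set \<Rightarrow> 'a set"
  where "S_radical R S I =
    {a \<in> carrier R. \<exists>s\<in>S. \<exists>n::nat. 0 < n \<and> s \<otimes>\<^bsub>R\<^esub> (a [^]\<^bsub>R\<^esub> n) \<in> I}"

definition fg_ideal :: "'a set \<Rightarrow> ('a, 'b) ring_scheme \<Rightarrow> bool"
  where "fg_ideal I R \<longleftrightarrow> (\<exists>A. finite A \<and> A \<subseteq> carrier R \<and> I = Idl\<^bsub>R\<^esub> A)"

lemma topspace_S_flat_topology:
  fixes R :: "('a, 'b) ring_scheme" and S :: "'a set"
  assumes "cring R" and "mult_closed_subset R S"
  shows "topspace (S_flat_topology R S) = Spec_S R S"
proof
  show "topspace (S_flat_topology R S) \<subseteq> Spec_S R S"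
    by (auto simp: S_flat_topology_def V_S_def)
next
  interpret cring R by fact
  interpret S: submonoid S R
    using assms(2) by (simp add: mult_closed_subset_def)
  have "P \<in> V_S R S {\<zero>\<^bsub>R\<^esub>}" if "P \<in> Spec_S R S" for P
  proof -
    have "ideal P R"
      using that by (simp add: Spec_S_def S_prime_def)
    then have "\<zero>\<^bsub>R\<^esub> \<in> P"
      by (simp add: additive_subgroup.zero_closed ideal.axioms(1))
    then have "\<one>\<^bsub>R\<^esub> \<otimes>\<^bsub>R\<^esub> \<zero>\<^bsub>R\<^esub> \<in> P"
      by simp
    then show ?thesis
      using that S.one_closed unfolding V_S_def by blast
  qed
  then show "Spec_S R S \<subseteq> topspace (S_flat_topology R S)"
    by (auto simp: S_flat_topology_def)
qed

end

theory Submission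
  imports Defs "HOL-Analysis.Function_Topology" "HOL-Algebra.Ring_Divisibility"
begin

text \<open>
  For an \<open>S\<close>-prime \<open>P\<close> let \<open>sat P\<close> be its \<open>saturation\<close> \<open>{a. s a \<in> P for some s \<in> S}\<close>, the contraction to \<open>R\<close> of the
  extension of \<open>P\<close> to the localization at \<open>S\<close>. It is a genuine prime ideal disjoint from \<open>S\<close>, it equals \<open>P\<close>
  if \<open>P\<close> itself is such a prime, and \<open>P\<close> lies in \<open>V\<^sub>S(E)\<close> iff \<open>E \<subseteq> sat P\<close> (\<open>V_S_eq\<close>). So the
  \<open>S\<close>-flat topology is pulled back, along a surjection, from the flat topology on the primes
  disjoint from \<open>S\<close>, and everything reduces to arguments with ordinary primes.

  The main point is that \<open>V\<^sub>S(I)\<close> is quasi-compact for \<^emph>\<open>every\<close> ideal \<open>I\<close> (\<open>compactin_V_S\<close>). By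
  Alexander's theorem it is enough to treat covers by sub-basic sets \<open>V\<^sub>S(f)\<close>. The elements \<open>t\<close> for
  which \<open>V\<^sub>S(t)\<close> has a finite subcover form a multiplicative set \<open>T\<close>, because
  \<open>V\<^sub>S(tu) = V\<^sub>S(t) \<union> V\<^sub>S(u)\<close>; it contains \<open>S\<close> and every \<open>f\<close> of the cover. If \<open>I\<close> missed
  \<open>T\<close>, Krull's lemma would give a prime containing \<open>I\<close> that is disjoint from \<open>T\<close>: a point of \<open>V\<^sub>S(I)\<close>
  lying in no member of the cover. Hence \<open>I\<close> contains some \<open>t \<in> T\<close>, and \<open>V\<^sub>S(I) \<subseteq> V\<^sub>S(t)\<close>
  has a finite subcover.

  The rest is formal. The sets \<open>V\<^sub>S(A)\<close> with \<open>A\<close> finite form a basis that is closed under finite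
  unions (take products of generators), so a quasi-compact open set is itself one of them. The
  whole space is \<open>V\<^sub>S\<close> of the zero ideal. If \<open>V\<^sub>S(I)\<close> is open, it is thus a quasi-compact open set and
  equals some \<open>V\<^sub>S(J)\<close> with \<open>J\<close> finitely generated; and \<open>V\<^sub>S(I)\<close> and the \<open>S\<close>-radical of \<open>I\<close>
  determine each other, the latter being the intersection of the \<open>sat P\<close> for \<open>P \<in> V\<^sub>S(I)\<close>
  (\<open>S_radical_eq_Inter\<close>).
\<close>

section \<open>Compact subsets of a generated topology\<close>

text \<open>
  The proof applies Alexander's theorem to \<open>U\<close> as a space of its own, with the traces of \<open>\<B>\<close> as
  sub-basis. There the empty intersection contributes the open set \<open>U\<close>, while \<open>generate_topology_on\<close> admits
  only nonempty intersections; the two topologies agree because \<open>\<B>\<close> covers \<open>U\<close>.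
\<close>

lemma Alexander_subbase_compactin:
  assumes U: "U \<subseteq> \<Union>\<B>"
    and fin: "\<And>\<C>. \<C> \<subseteq> \<B> \<Longrightarrow> U \<subseteq> \<Union>\<C> \<Longrightarrow> \<exists>\<C>'. finite \<C>' \<and> \<C>' \<subseteq> \<C> \<and> U \<subseteq> \<Union>\<C>'"
  shows "compactin (topology_generated_by \<B>) U"
proof -
  let ?X = "topology_generated_by \<B>"
  let ?P = "finite intersection_of (\<lambda>x. x \<in> \<B>) relative_to U"
  let ?Y = "topology (arbitrary union_of ?P)"
  have openY: "openin ?Y = arbitrary union_of ?P"
    by (rule topology_inverse') (rule istopology_subbase)
  have PY: "openin ?Y W" if "?P W" for W
    unfolding openY by (rule arbitrary_union_of_inc) (rule that)
  have P_subtop: "openin (subtopology ?X U) W" if "?P W" for W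
  proof -
    from that obtain V where "(finite intersection_of (\<lambda>x. x \<in> \<B>)) V" and W: "U \<inter> V = W"
      unfolding relative_to_def by (elim exE conjE)
    then obtain \<F> where "finite \<F>" "\<F> \<subseteq> \<B>" "\<Inter>\<F> = V"
      unfolding intersection_of_def Collect_mem_eq by (elim exE conjE)
    with W have \<F>: "finite \<F>" "\<F> \<subseteq> \<B>" "U \<inter> \<Inter>\<F> = W"
      by simp_all
    show ?thesis
    proof (cases "\<F> = {}")
      case True
      moreover have "U \<subseteq> topspace ?X"
        using U by simp
      ultimately show ?thesis
        using \<F>(3) openin_subtopology_refl[of ?X U] by simp
    next
      case False
      then have "openin ?X (\<Inter>\<F>)"
        using \<F> by (intro openin_Inter) (auto intro: topology_generated_by_Basis)
      then show ?thesis
        unfolding \<F>(3)[symmetric] by (rule openin_subtopology_Int2)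
    qed
  qed
  have 1: "openin (subtopology ?X U) W" if "openin ?Y W" for W
  proof -
    from that[unfolded openY] obtain \<U> where "\<U> \<subseteq> Collect ?P" "\<Union>\<U> = W"
      unfolding union_of_def by (elim exE conjE)
    then show ?thesis
      using P_subtop by blast
  qed
  have "openin ?Y (U \<inter> W)" if "generate_topology_on \<B> W" for W
    using that
  proof induction
    case Empty
    then show ?case by simp
  next
    case (Int a b)
    have "openin ?Y ((U \<inter> a) \<inter> (U \<inter> b))"
      by (rule openin_Int[OF Int.IH])
    moreover have "(U \<inter> a) \<inter> (U \<inter> b) = U \<inter> (a \<inter> b)"
      by blast
    ultimately show ?case by simp
  next
    case (UN K)
    then have "openin ?Y (\<Union>k\<in>K. U \<inter> k)"
      by (intro openin_Union) auto
    then show ?case by (simp only: Int_Union)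
  next
    case (Basis s)
    then have "?P (U \<inter> s)"
      by (intro relative_to_inc intersection_of_inc) auto
    then show ?case by (rule PY)
  qed
  then have 2: "openin ?Y W" if "openin (subtopology ?X U) W" for W
    using that
    by (auto simp: openin_subtopology openin_topology_generated_by_iff Int_commute)
  have "?Y = subtopology ?X U"
    unfolding topology_eq using 1 2 by blast
  from U fin this have "compact_space (subtopology ?X U)"
    by (rule Alexander_subbase_alt)
  then show ?thesis
    using U by (simp add: compactin_subspace)
qed

section \<open>Primes avoiding a multiplicative set\<close>

text \<open>
  Krull's lemma: an ideal \<open>M\<close> that is maximal among those containing \<open>I\<close> and missing \<open>T\<close> is prime.
  Colon ideals replace the usual sums of ideals: if \<open>c d \<in> M\<close> and \<open>d \<notin> M\<close>, then
  \<open>M : c\<close> is strictly larger than \<open>M\<close>, hence meets \<open>T\<close>.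
\<close>

lemma (in cring) exists_primeideal_avoiding:
  assumes T: "submonoid T R" and I: "ideal I R" and disj: "I \<inter> T = {}"
  shows "\<exists>Q. primeideal Q R \<and> I \<subseteq> Q \<and> Q \<inter> T = {}"
proof -
  interpret T: submonoid T R by fact
  let ?A = "{J. ideal J R \<and> I \<subseteq> J \<and> J \<inter> T = {}}"
  have "\<exists>M\<in>?A. \<forall>J\<in>?A. M \<subseteq> J \<longrightarrow> J = M"
  proof (rule subset_Zorn_nonempty)
    show "?A \<noteq> {}"
      using I disj by blast
    fix \<C> assume ne: "\<C> \<noteq> {}" and ch: "subset.chain ?A \<C>"
    have "subset.chain {J. ideal J R} \<C>"
      using ch by (auto simp: subset_chain_def)
    then have "ideal (\<Union>\<C>) R"
      using chain_Union_is_ideal[of \<C>] ne by simp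
    moreover have "I \<subseteq> J" "J \<inter> T = {}" if "J \<in> \<C>" for J
      using that ch by (auto simp: subset_chain_def)
    then have "I \<subseteq> \<Union>\<C>" "\<Union>\<C> \<inter> T = {}"
      using ne by blast+
    ultimately show "\<Union>\<C> \<in> ?A"
      by blast
  qed
  then obtain M where M_in: "M \<in> ?A" and M_max: "\<forall>J\<in>?A. M \<subseteq> J \<longrightarrow> J = M" ..
  then have M: "ideal M R" "I \<subseteq> M" "M \<inter> T = {}"
    by simp_all
  have max: "J = M" if "ideal J R" "I \<subseteq> J" "J \<inter> T = {}" "M \<subseteq> J" for J
    using M_max that by simp
  interpret M: ideal M R by fact
  have colon: "\<exists>t\<in>T. c \<otimes> t \<in> M"
    if "c \<in> carrier R" "d \<in> carrier R" "c \<otimes> d \<in> M" "d \<notin> M" for c d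
  proof (rule ccontr)
    assume neg: "\<not> (\<exists>t\<in>T. c \<otimes> t \<in> M)"
    let ?J = "{x \<in> carrier R. c \<otimes> x \<in> M}"
    have "ideal ?J R"
      using M.helper_max_prime[OF is_cring that(1)] .
    moreover have "M \<subseteq> ?J"
      using that(1) M.I_l_closed M.Icarr by blast
    ultimately have "?J = M"
      using M(2) neg by (intro max) auto
    then show False
      using that by blast
  qed
  have "primeideal M R"
  proof (rule primeidealI[OF M(1) is_cring])
    show "carrier R \<noteq> M"
      using M(3) T.one_closed T.subset by blast
    fix a b assume ab: "a \<in> carrier R" "b \<in> carrier R" "a \<otimes> b \<in> M"
    show "a \<in> M \<or> b \<in> M"
    proof (rule ccontr)
      assume n: "\<not> (a \<in> M \<or> b \<in> M)"
      \<comment> \<open>Trade first \<open>b\<close>, then \<open>a\<close>, for an element of \<open>T\<close>; the product of the two lies in \<open>M \<inter> T\<close>.\<close>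
      then obtain t where t: "t \<in> T" "a \<otimes> t \<in> M"
        using colon[of a b] ab by blast
      then obtain u where "u \<in> T" "t \<otimes> u \<in> M"
        using colon[of t a] ab n by (metis T.mem_carrier m_comm)
      then show False
        using t(1) M(3) T.m_closed by blast
    qed
  qed
  then show ?thesis
    using M by blast
qed

section \<open>From S-primes to primes disjoint from S\<close>

locale cring_mult_closed = cring R for R (structure) +
  fixes S :: "'a set"
  assumes mult_closed: "mult_closed_subset R S"

sublocale cring_mult_closed \<subseteq> S: submonoid S R
  using mult_closed by (simp add: mult_closed_subset_def)

context cring_mult_closed
begin

definition saturation :: "'a set \<Rightarrow> 'a set"
  where "saturation P = {a \<in> carrier R. \<exists>s\<in>S. s \<otimes> a \<in> P}"

text \<open>
  The element \<open>s\<close> witnessing that \<open>P\<close> is \<open>S\<close>-prime works for all members of the saturation at once: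
  from \<open>t a \<in> P\<close> with \<open>t \<in> S\<close> follows \<open>s t \<in> P\<close> or \<open>s a \<in> P\<close>, and
  \<open>s t \<in> S\<close> excludes the former. So the saturation is the colon ideal \<open>P : s\<close>, and one multiplier
  suffices for a whole set \<open>E\<close>, as the definition of \<open>V\<^sub>S(E)\<close> demands.
\<close>

lemma saturation_uniform:
  assumes "P \<in> Spec_S R S"
  obtains s where "s \<in> S" "saturation P = {a \<in> carrier R. s \<otimes> a \<in> P}"
    "\<And>a b. a \<in> carrier R \<Longrightarrow> b \<in> carrier R \<Longrightarrow> a \<otimes> b \<in> P \<Longrightarrow> s \<otimes> a \<in> P \<or> s \<otimes> b \<in> P"
proof -
  obtain s where s: "s \<in> S"
    "\<And>a b. a \<in> carrier R \<Longrightarrow> b \<in> carrier R \<Longrightarrow> a \<otimes> b \<in> P \<Longrightarrow> s \<otimes> a \<in> P \<or> s \<otimes> b \<in> P"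
    and disj: "P \<inter> S = {}"
    using assms unfolding Spec_S_def S_prime_def by blast
  have "s \<otimes> a \<in> P" if "a \<in> carrier R" "t \<in> S" "t \<otimes> a \<in> P" for a t
    using s(2)[of t a] that s(1) disj S.m_closed[of s t] by auto
  then have "saturation P = {a \<in> carrier R. s \<otimes> a \<in> P}"
    using s(1) by (auto simp: saturation_def)
  then show thesis
    using that s by blast
qed

text \<open>
  With \<open>s\<close> as above, \<open>s a b \<in> P\<close> gives \<open>s s a \<in> P\<close> or \<open>s b \<in> P\<close>. The surplus factor \<open>s\<close> is
  harmless because any multiplier from \<open>S\<close> may witness membership in the saturation.
\<close>

lemma primeideal_saturation:
  assumes "P \<in> Spec_S R S"
  shows "primeideal (saturation P) R"
proof -
  obtain s where s: "s \<in> S" and sat: "saturation P = {a \<in> carrier R. s \<otimes> a \<in> P}"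
    and pr: "\<And>a b. a \<in> carrier R \<Longrightarrow> b \<in> carrier R \<Longrightarrow> a \<otimes> b \<in> P \<Longrightarrow> s \<otimes> a \<in> P \<or> s \<otimes> b \<in> P"
    using saturation_uniform[OF assms] by blast
  have P: "ideal P R" "P \<inter> S = {}"
    using assms by (auto simp: Spec_S_def S_prime_def)
  show ?thesis
  proof (rule primeidealI[OF _ is_cring])
    show "ideal (saturation P) R"
      unfolding sat using ideal.helper_max_prime[OF P(1) is_cring] s by simp
    have "\<one> \<notin> saturation P"
      using s P(2) by (auto simp: sat)
    then show "carrier R \<noteq> saturation P"
      by auto
    fix a b assume ab: "a \<in> carrier R" "b \<in> carrier R" "a \<otimes> b \<in> saturation P"
    then have "(s \<otimes> a) \<otimes> b \<in> P"
      using s by (simp add: sat m_assoc)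
    then have "s \<otimes> (s \<otimes> a) \<in> P \<or> s \<otimes> b \<in> P"
      using pr ab s by simp
    moreover have "s \<otimes> (s \<otimes> a) = (s \<otimes> s) \<otimes> a"
      using ab s by (simp add: m_assoc)
    ultimately show "a \<in> saturation P \<or> b \<in> saturation P"
      using ab s by (auto simp: saturation_def)
  qed
qed

lemma saturation_disjoint:
  assumes "P \<in> Spec_S R S"
  shows "saturation P \<inter> S = {}"
proof -
  have "P \<inter> S = {}"
    using assms by (simp add: Spec_S_def S_prime_def)
  then show ?thesis
    using S.m_closed unfolding saturation_def by blast
qed

lemma
  assumes Q: "primeideal Q R" and disj: "Q \<inter> S = {}"
  shows primeideal_in_Spec_S: "Q \<in> Spec_S R S"
    and saturation_primeideal: "saturation Q = Q"
proof -
  interpret Q: primeideal Q R by fact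
  have "\<exists>s\<in>S. \<forall>a\<in>carrier R. \<forall>b\<in>carrier R. a \<otimes> b \<in> Q \<longrightarrow> s \<otimes> a \<in> Q \<or> s \<otimes> b \<in> Q"
    using Q.I_prime by (intro bexI[OF _ S.one_closed]) auto
  then show "Q \<in> Spec_S R S"
    using disj Q.ideal_axioms by (simp add: Spec_S_def S_prime_def)
  show "saturation Q = Q"
  proof
    show "saturation Q \<subseteq> Q"
      using disj Q.I_prime S.subset unfolding saturation_def by blast
    show "Q \<subseteq> saturation Q"
    proof
      fix a assume "a \<in> Q"
      then have "a \<in> carrier R" "\<one> \<otimes> a \<in> Q"
        using Q.Icarr by auto
      then show "a \<in> saturation Q"
        using S.one_closed unfolding saturation_def by blast
    qed
  qed
qed

section \<open>The sets V_S(E) and the topology they generate\<close>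

lemma V_S_iff:
  assumes "E \<subseteq> carrier R"
  shows "P \<in> V_S R S E \<longleftrightarrow> P \<in> Spec_S R S \<and> E \<subseteq> saturation P"
proof (cases "P \<in> Spec_S R S")
  case True
  obtain s where s: "s \<in> S" "saturation P = {a \<in> carrier R. s \<otimes> a \<in> P}"
    by (rule saturation_uniform[OF True])
  show ?thesis
  proof
    assume "P \<in> V_S R S E"
    then show "P \<in> Spec_S R S \<and> E \<subseteq> saturation P"
      using assms unfolding V_S_def saturation_def by blast
  next
    assume "P \<in> Spec_S R S \<and> E \<subseteq> saturation P"
    then show "P \<in> V_S R S E"
      using s unfolding V_S_def by blast
  qed
qed (simp add: V_S_def)

lemma V_S_eq:
  assumes "E \<subseteq> carrier R"
  shows "V_S R S E = {P \<in> Spec_S R S. E \<subseteq> saturation P}"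
  using V_S_iff[OF assms] by blast

lemma V_S_genideal:
  assumes "A \<subseteq> carrier R"
  shows "V_S R S (Idl A) = V_S R S A"
proof -
  have "Idl A \<subseteq> saturation P \<longleftrightarrow> A \<subseteq> saturation P" if "P \<in> Spec_S R S" for P
    using Idl_subset_ideal[OF primeideal.axioms(1)[OF primeideal_saturation[OF that]] assms] .
  moreover have "Idl A \<subseteq> carrier R"
    using ideal.Icarr[OF genideal_ideal[OF assms]] by blast
  ultimately show ?thesis
    using assms by (auto simp: V_S_eq)
qed

text \<open>
  A prime contains all products \<open>a b\<close> iff it contains \<open>A\<close> or contains \<open>B\<close>. Working with generators
  avoids products of ideals and keeps finiteness visible.
\<close>

lemma V_S_Un:
  assumes A: "A \<subseteq> carrier R" and B: "B \<subseteq> carrier R"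
  shows "V_S R S A \<union> V_S R S B = V_S R S ((\<lambda>(a, b). a \<otimes> b) ` (A \<times> B))"
proof -
  let ?AB = "(\<lambda>(a, b). a \<otimes> b) ` (A \<times> B)"
  have AB: "?AB \<subseteq> carrier R"
    using A B by auto
  have "?AB \<subseteq> saturation P \<longleftrightarrow> A \<subseteq> saturation P \<or> B \<subseteq> saturation P"
    if "P \<in> Spec_S R S" for P
  proof -
    interpret Q: primeideal "saturation P" R
      by (rule primeideal_saturation[OF that])
    show ?thesis
    proof
      assume L: "?AB \<subseteq> saturation P"
      show "A \<subseteq> saturation P \<or> B \<subseteq> saturation P"
      proof (rule ccontr)
        assume "\<not> (A \<subseteq> saturation P \<or> B \<subseteq> saturation P)"
        then obtain a b where "a \<in> A" "b \<in> B" "a \<notin> saturation P" "b \<notin> saturation P"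
          by blast
        moreover from this have "a \<otimes> b \<in> saturation P"
          using L by force
        ultimately show False
          using Q.I_prime[of a b] A B by blast
      qed
    qed (use A B Q.I_l_closed Q.I_r_closed in \<open>auto 0 4\<close>)
  qed
  then show ?thesis
    unfolding V_S_eq[OF A] V_S_eq[OF B] V_S_eq[OF AB] by blast
qed

lemma V_S_singleton_eq_empty:
  assumes "s \<in> S"
  shows "V_S R S {s} = {}"
proof -
  have "s \<notin> saturation P" if "P \<in> Spec_S R S" for P
    using saturation_disjoint[OF that] assms by blast
  then show ?thesis
    using assms by (auto simp: V_S_eq)
qed

lemma V_S_empty: "V_S R S {} = Spec_S R S"
  by (simp add: V_S_eq)

lemma openin_V_S_finite:
  assumes "finite A" "A \<subseteq> carrier R"
  shows "openin (S_flat_topology R S) (V_S R S A)"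
proof (cases "A = {}")
  case True
  then show ?thesis
    using topspace_S_flat_topology[OF is_cring mult_closed] V_S_empty by (metis openin_topspace)
next
  case False
  have "V_S R S A = (\<Inter>a\<in>A. V_S R S {a})"
    using assms(2) False by (auto simp: V_S_eq subset_iff)
  moreover have "openin (S_flat_topology R S) (\<Inter>a\<in>A. V_S R S {a})"
    using assms False unfolding S_flat_topology_def
    by (intro openin_Inter) (auto intro!: topology_generated_by_Basis)
  ultimately show ?thesis by simp
qed

lemma openin_S_flat_topology_basis:
  assumes "openin (S_flat_topology R S) U" "P \<in> U"
  shows "\<exists>A. finite A \<and> A \<subseteq> carrier R \<and> P \<in> V_S R S A \<and> V_S R S A \<subseteq> U"
proof -
  have "generate_topology_on {V_S R S {f} | f. f \<in> carrier R} U"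
    using assms(1) by (simp add: S_flat_topology_def openin_topology_generated_by_iff)
  then show ?thesis
    using assms(2)
  proof induction
    case (Int U W)
    then obtain A B where A: "finite A" "A \<subseteq> carrier R" "P \<in> V_S R S A" "V_S R S A \<subseteq> U"
      and B: "finite B" "B \<subseteq> carrier R" "P \<in> V_S R S B" "V_S R S B \<subseteq> W"
      by auto
    have "V_S R S (A \<union> B) = V_S R S A \<inter> V_S R S B"
      using A(2) B(2) by (auto simp: V_S_eq)
    then show ?case
      using A B by (intro exI[of _ "A \<union> B"]) auto
  next
    case (UN K)
    then show ?case by (meson Sup_upper UnionE order_trans)
  next
    case (Basis U)
    then show ?case by blast
  qed auto
qed

text \<open>
  The central step. The set \<open>T\<close> in the proof plays the part of the multiplicative set generated by \<open>S\<close>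
  and the \<open>f\<close> with \<open>V\<^sub>S(f)\<close> in the cover; describing it by the existence of a finite subcover
  makes explicit products of generators unnecessary.
\<close>

lemma compactin_V_S:
  assumes I: "ideal I R"
  shows "compactin (S_flat_topology R S) (V_S R S I)"
  unfolding S_flat_topology_def
proof (rule Alexander_subbase_compactin)
  interpret I: ideal I R by fact
  have I_carr: "I \<subseteq> carrier R"
    using I.Icarr by blast
  show "V_S R S I \<subseteq> \<Union>{V_S R S {f} | f. f \<in> carrier R}"
    using topspace_S_flat_topology[OF is_cring mult_closed]
    by (auto simp: S_flat_topology_def V_S_def)
  fix \<C> assume \<C>: "\<C> \<subseteq> {V_S R S {f} | f. f \<in> carrier R}" and cover: "V_S R S I \<subseteq> \<Union>\<C>"
  define T where
    "T = {t \<in> carrier R. \<exists>\<C>'. finite \<C>' \<and> \<C>' \<subseteq> \<C> \<and> V_S R S {t} \<subseteq> \<Union>\<C>'}"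
  have S_T: "S \<subseteq> T"
  proof
    fix s assume s: "s \<in> S"
    then have "V_S R S {s} = {}"
      by (rule V_S_singleton_eq_empty)
    then show "s \<in> T"
      using s by (auto simp: T_def intro!: exI[of _ "{}"])
  qed
  have "submonoid T R"
  proof
    show "T \<subseteq> carrier R"
      by (auto simp: T_def)
    show "\<one> \<in> T"
      using S_T S.one_closed by blast
    fix t u assume "t \<in> T" "u \<in> T"
    then obtain \<C>1 \<C>2 where tu: "t \<in> carrier R" "u \<in> carrier R"
      and 1: "finite \<C>1" "\<C>1 \<subseteq> \<C>" "V_S R S {t} \<subseteq> \<Union>\<C>1"
      and 2: "finite \<C>2" "\<C>2 \<subseteq> \<C>" "V_S R S {u} \<subseteq> \<Union>\<C>2"
      by (auto simp: T_def)
    have "V_S R S {t \<otimes> u} = V_S R S {t} \<union> V_S R S {u}"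
      using V_S_Un[of "{t}" "{u}"] tu by simp
    then have "V_S R S {t \<otimes> u} \<subseteq> \<Union>(\<C>1 \<union> \<C>2)"
      using 1 2 by blast
    then show "t \<otimes> u \<in> T"
      using tu 1 2 by (auto simp: T_def intro!: exI[of _ "\<C>1 \<union> \<C>2"])
  qed
  have "I \<inter> T \<noteq> {}"
  proof
    assume "I \<inter> T = {}"
    then obtain Q where Q: "primeideal Q R" "I \<subseteq> Q" "Q \<inter> T = {}"
      using exists_primeideal_avoiding \<open>submonoid T R\<close> I by blast
    then have "Q \<inter> S = {}"
      using S_T by blast
    then have spec: "Q \<in> Spec_S R S" and sat: "saturation Q = Q"
      using Q(1) primeideal_in_Spec_S saturation_primeideal by auto
    then have "Q \<in> V_S R S I"
      using I_carr Q(2) by (simp add: V_S_eq)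
    then obtain f where f: "f \<in> carrier R" "V_S R S {f} \<in> \<C>" "Q \<in> V_S R S {f}"
      using cover \<C> by blast
    then have "f \<in> T"
      by (auto simp: T_def intro!: exI[of _ "{V_S R S {f}}"])
    moreover have "f \<in> Q"
      using f sat by (simp add: V_S_eq)
    ultimately show False
      using Q(3) by blast
  qed
  then obtain t \<C>' where t: "t \<in> I" and \<C>': "finite \<C>'" "\<C>' \<subseteq> \<C>" "V_S R S {t} \<subseteq> \<Union>\<C>'"
    by (auto simp: T_def)
  have "V_S R S I \<subseteq> V_S R S {t}"
    using t by (auto simp: V_S_def)
  then show "\<exists>\<C>'. finite \<C>' \<and> \<C>' \<subseteq> \<C> \<and> V_S R S I \<subseteq> \<Union>\<C>'"
    using \<C>' by blast
qed

lemma finite_Union_V_S: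
  assumes "finite \<F>" "\<And>W. W \<in> \<F> \<Longrightarrow> \<exists>A. finite A \<and> A \<subseteq> carrier R \<and> W = V_S R S A"
  shows "\<exists>A. finite A \<and> A \<subseteq> carrier R \<and> \<Union>\<F> = V_S R S A"
  using assms
proof (induction \<F>)
  case empty
  then show ?case
    using V_S_singleton_eq_empty[OF S.one_closed] by (intro exI[of _ "{\<one>}"]) simp
next
  case (insert W \<F>)
  then obtain A B where A: "finite A" "A \<subseteq> carrier R" "\<Union>\<F> = V_S R S A"
    and B: "finite B" "B \<subseteq> carrier R" "W = V_S R S B"
    by force
  let ?BA = "(\<lambda>(b, a). b \<otimes> a) ` (B \<times> A)"
  have "\<Union>(insert W \<F>) = V_S R S ?BA"
    using A(3) B(3) V_S_Un[OF B(2) A(2)] by simp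
  moreover have "finite ?BA" "?BA \<subseteq> carrier R"
    using A B by auto
  ultimately show ?case by blast
qed

lemma fg_ideal_imp_ideal: "fg_ideal J R \<Longrightarrow> ideal J R"
  using genideal_ideal by (auto simp: fg_ideal_def)

lemma compact_open_iff_V_S_fg:
  "openin (S_flat_topology R S) U \<and> compactin (S_flat_topology R S) U \<longleftrightarrow>
    (\<exists>J. fg_ideal J R \<and> U = V_S R S J)"
proof
  assume U: "openin (S_flat_topology R S) U \<and> compactin (S_flat_topology R S) U"
  let ?\<B> = "{V_S R S A | A. finite A \<and> A \<subseteq> carrier R \<and> V_S R S A \<subseteq> U}"
  have "\<forall>W\<in>?\<B>. openin (S_flat_topology R S) W"
    using openin_V_S_finite by blast
  moreover have "U \<subseteq> \<Union>?\<B>"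
  proof
    fix P assume "P \<in> U"
    then obtain A where "finite A" "A \<subseteq> carrier R" "P \<in> V_S R S A" "V_S R S A \<subseteq> U"
      using openin_S_flat_topology_basis[of U P] U by blast
    then show "P \<in> \<Union>?\<B>"
      by blast
  qed
  ultimately obtain \<F> where \<F>: "finite \<F>" "\<F> \<subseteq> ?\<B>" "U \<subseteq> \<Union>\<F>"
    using U unfolding compactin_def by meson
  then have "\<exists>A. finite A \<and> A \<subseteq> carrier R \<and> \<Union>\<F> = V_S R S A"
    by (intro finite_Union_V_S) auto
  moreover have "\<Union>\<F> = U"
    using \<F> by blast
  ultimately obtain A where "finite A" "A \<subseteq> carrier R" "U = V_S R S A"
    by auto
  then show "\<exists>J. fg_ideal J R \<and> U = V_S R S J"
    using V_S_genideal by (auto simp: fg_ideal_def)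
next
  assume "\<exists>J. fg_ideal J R \<and> U = V_S R S J"
  then obtain A where A: "finite A" "A \<subseteq> carrier R" "U = V_S R S (Idl A)"
    by (auto simp: fg_ideal_def)
  then show "openin (S_flat_topology R S) U \<and> compactin (S_flat_topology R S) U"
    using compactin_V_S[OF genideal_ideal[OF A(2)]] openin_V_S_finite[OF A(1,2)]
      V_S_genideal[OF A(2)] by simp
qed

section \<open>The S-radical\<close>

text \<open>
  The analogue of the fact that the radical is the intersection of the primes above \<open>I\<close>. If no
  \<open>s a\<^sup>n\<close> lies in \<open>I\<close>, Krull's lemma for the multiplicative set of all \<open>s a\<^sup>n\<close> yields a prime in
  \<open>V\<^sub>S(I)\<close> without \<open>a\<close>.
\<close>

lemma S_radical_eq_Inter:
  assumes I: "ideal I R"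
  shows "S_radical R S I = {a \<in> carrier R. \<forall>P\<in>V_S R S I. a \<in> saturation P}"
proof (intro equalityI subsetI)
  interpret I: ideal I R by fact
  have I_carr: "I \<subseteq> carrier R"
    using I.Icarr by blast
  {
    fix a assume "a \<in> S_radical R S I"
    then obtain s and n :: nat where a: "a \<in> carrier R" and s: "s \<in> S" "s \<otimes> a [^] n \<in> I"
      by (auto simp: S_radical_def)
    have "a \<in> saturation P" if "P \<in> V_S R S I" for P
    proof -
      have P: "P \<in> Spec_S R S" "I \<subseteq> saturation P"
        using that V_S_eq[OF I_carr] by auto
      interpret Q: primeideal "saturation P" R
        by (rule primeideal_saturation[OF P(1)])
      have "a [^] n \<in> saturation P"
        using Q.I_prime[of s "a [^] n"] s a P saturation_disjoint[OF P(1)] by auto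
      then show ?thesis
      proof (induction n)
        case 0
        moreover have "\<one> \<notin> saturation P"
          using saturation_disjoint[OF P(1)] S.one_closed by blast
        ultimately show ?case by simp
      next
        case (Suc n)
        then show ?case
          using Q.I_prime[of "a [^] n" a] a by auto
      qed
    qed
    then show "a \<in> {a \<in> carrier R. \<forall>P\<in>V_S R S I. a \<in> saturation P}"
      using a by blast
  next
    fix a assume "a \<in> {a \<in> carrier R. \<forall>P\<in>V_S R S I. a \<in> saturation P}"
    then have a: "a \<in> carrier R" and mem: "\<And>P. P \<in> V_S R S I \<Longrightarrow> a \<in> saturation P"
      by auto
    let ?T = "{s \<otimes> a [^] n | s n. s \<in> S \<and> n \<in> (UNIV :: nat set)}"
    have S_T: "S \<subseteq> ?T"
    proof
      fix s assume "s \<in> S"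
      moreover from this have "s = s \<otimes> a [^] (0::nat)"
        by simp
      ultimately show "s \<in> ?T"
        by blast
    qed
    have T: "submonoid ?T R"
    proof
      show "?T \<subseteq> carrier R"
        using a by auto
      show "\<one> \<in> ?T"
        using S_T S.one_closed by blast
      fix x y assume "x \<in> ?T" "y \<in> ?T"
      then obtain s m u n where x: "x = s \<otimes> a [^] (m::nat)" "s \<in> S"
        and y: "y = u \<otimes> a [^] (n::nat)" "u \<in> S"
        by blast
      have "x \<otimes> y = (s \<otimes> u) \<otimes> (a [^] m \<otimes> a [^] n)"
        using x y a by (simp add: m_ac)
      also have "\<dots> = (s \<otimes> u) \<otimes> a [^] (m + n)"
        using a by (simp add: nat_pow_mult)
      finally show "x \<otimes> y \<in> ?T"
        using x y by blast
    qed
    have "I \<inter> ?T \<noteq> {}"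
    proof
      assume "I \<inter> ?T = {}"
      then obtain Q where Q: "primeideal Q R" "I \<subseteq> Q" "Q \<inter> ?T = {}"
        using exists_primeideal_avoiding[OF T I] by blast
      have "Q \<inter> S = {}"
        using Q(3) S_T by blast
      then have spec: "Q \<in> Spec_S R S" and sat: "saturation Q = Q"
        using Q(1) primeideal_in_Spec_S saturation_primeideal by auto
      then have "a \<in> Q"
        using mem[of Q] spec I_carr Q(2) by (simp add: V_S_eq)
      moreover have "a = \<one> \<otimes> a [^] (1::nat)"
        using a by simp
      then have "a \<in> ?T"
        using S.one_closed by blast
      ultimately show False
        using Q(3) by blast
    qed
    then obtain s and n :: nat where s: "s \<in> S" "s \<otimes> a [^] n \<in> I"
      by blast
    \<comment> \<open>The exponent \<open>n\<close> may be \<open>0\<close> here, whereas the \<open>S\<close>-radical asks for a positive one.\<close>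
    then have "(s \<otimes> a [^] n) \<otimes> a \<in> I"
      using a I.I_r_closed by blast
    then have "s \<otimes> a [^] Suc n \<in> I"
      using s a by (simp add: m_assoc)
    then show "a \<in> S_radical R S I"
      using a s(1) unfolding S_radical_def by blast
  }
qed

lemma V_S_S_radical:
  assumes I: "ideal I R"
  shows "V_S R S (S_radical R S I) = V_S R S I"
proof -
  interpret I: ideal I R by fact
  have I_carr: "I \<subseteq> carrier R"
    using I.Icarr by blast
  have rad: "S_radical R S I \<subseteq> carrier R" "I \<subseteq> S_radical R S I"
    "\<And>P. P \<in> V_S R S I \<Longrightarrow> S_radical R S I \<subseteq> saturation P"
    using I_carr V_S_eq[OF I_carr] by (auto simp: S_radical_eq_Inter[OF I])
  have "S_radical R S I \<subseteq> saturation P \<longleftrightarrow> I \<subseteq> saturation P" if "P \<in> Spec_S R S" for P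
  proof
    assume "I \<subseteq> saturation P"
    then have "P \<in> V_S R S I"
      using that by (simp add: V_S_eq[OF I_carr])
    then show "S_radical R S I \<subseteq> saturation P"
      by (rule rad(3))
  qed (use rad(2) in blast)
  then show ?thesis
    by (auto simp: V_S_eq[OF I_carr] V_S_eq[OF rad(1)])
qed

lemma S_radical_eq_iff_V_S_eq:
  assumes "ideal I R" "ideal J R"
  shows "S_radical R S I = S_radical R S J \<longleftrightarrow> V_S R S I = V_S R S J"
proof
  assume "S_radical R S I = S_radical R S J"
  then show "V_S R S I = V_S R S J"
    using V_S_S_radical[OF assms(1)] V_S_S_radical[OF assms(2)] by simp
qed (simp add: S_radical_eq_Inter assms)

end

theorem corollary4p3:
  fixes R :: "('a, 'b) ring_scheme" and S :: "'a set"
  assumes "cring R" and "\<one>\<^bsub>R\<^esub> \<noteq> \<zero>\<^bsub>R\<^esub>" and "mult_closed_subset R S"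
  shows "{U. openin (S_flat_topology R S) U \<and> compactin (S_flat_topology R S) U} =
           {V_S R S I | I. fg_ideal I R} \<and>
         compact_space (S_flat_topology R S) \<and>
         (\<forall>I. ideal I R \<longrightarrow>
           (openin (S_flat_topology R S) (V_S R S I) \<longleftrightarrow>
            (\<exists>J. fg_ideal J R \<and> S_radical R S I = S_radical R S J)))"
proof -
  interpret cring_mult_closed R S
    using assms by (intro cring_mult_closed.intro cring_mult_closed_axioms.intro)
  have "V_S R S (Idl\<^bsub>R\<^esub> {}) = topspace (S_flat_topology R S)"
    using V_S_genideal V_S_empty topspace_S_flat_topology[OF is_cring mult_closed] by simp
  then have "compact_space (S_flat_topology R S)"
    using compactin_V_S[OF genideal_ideal[of "{}"]] by (simp add: compact_space_def)
  \<comment> \<open>\<open>V\<^sub>S(I)\<close> is always compact, so it is open iff it is a compact open set.\<close>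
  moreover have "openin (S_flat_topology R S) (V_S R S I) \<longleftrightarrow>
      (\<exists>J. fg_ideal J R \<and> S_radical R S I = S_radical R S J)" if "ideal I R" for I
    using compact_open_iff_V_S_fg[of "V_S R S I"] compactin_V_S[OF that]
      S_radical_eq_iff_V_S_eq[OF that] fg_ideal_imp_ideal by blast
  ultimately show ?thesis
    using compact_open_iff_V_S_fg by blast
qed

end
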